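(* Let $\mathbb{P}$ be the set of all process terms. Let $$\mathfrak{U} = \{P \in \mathbb{P} \mid \exists\, \Gamma, \Delta, \Lambda \text{ such that } \Gamma; \Delta \vdash P :: \Lambda\}$$ be the set of processes typable in the type system $\pi\mathsf{ULL}$, and let $$\mathfrak{I} = \{P \in \mathbb{P} \mid \exists\, \Gamma, \Delta,\ x \in \mathrm{fn}(P),\ A \text{ such that } \Gamma; \Delta \vdash_{\mathsf{ILL}} P :: x:A\}$$ be the set of processes typable in the intuitionistic type system $\pi\mathsf{ILL}$. Then $\mathfrak{I}$ is a strict subset of $\mathfrak{U}$: $\mathfrak{I} \subset \mathfrak{U}$ and $\mathfrak{I}\neq\mathfrak{U}$.
   Context: **Types.** $A,B ::= \mathbf{1} \mid \bot \mid A \otimes B \mid A ⅋ B \mid A \multimap B \mid\ !A \mid\ ?A$ (no atoms). Duality: $\mathbf{1}^\perp=\bot$, $\bot^\perp=\mathbf{1}$, $(A\otimes B)^\perp = A^\perp ⅋ B^\perp$, $(A ⅋ B)^\perp = A^\perp\otimes B^\perp$, $(!A)^\perp = {?}A^\perp$, $(?A)^\perp = {!}A^\perp$. By decree $A\multimap B = A^\perp ⅋ B$ (these are identified). Duality is an involution. **Processes.** $P,Q ::= \mathbf{0} \mid [x\leftrightarrow y] \mid (\nu x)P \mid P|Q \mid x\langle y\rangle.P \mid x(y).P \mid\ !x(y).P \mid x\langle\rangle.\mathbf{0} \mid x().P$. The constructs $(\nu x)P$, $z(x).P$, $!z(x).P$ bind $x$ in $P$; the output $x\langle y\rangle.P$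 binds nothing. $\mathrm{fn}(P)$ is the set of free names of $P$. $P\{y/x\}$ is capture-avoiding substitution of $y$ for free $x$. Terms are taken up to $\alpha$-conversion. **Contexts.** $\Gamma,\Delta,\Lambda$ are finite unordered collections of assignments $x:A$ with pairwise distinct names; a comma denotes disjoint union, $\cdot$ is empty. $\Gamma$ is unrestricted, the others are linear. **System $\pi\mathsf{ULL}$** (judgments $\Gamma;\Delta\vdash P::\Lambda$; premises $\Rightarrow$ conclusion; primed contexts are arbitrary). Some rules are marked $\ast$: - $\ast$ Id R: $\Gamma; x:A \vdash [x\leftrightarrow y] :: y:A$. - Id L: $\Gamma; x:A, y:A^\perp \vdash [x\leftrightarrow y] :: \cdot$. - $\ast$ Cut R: $\Gamma;\Delta\vdash P::\Lambda,x:A$ and $\Gamma;\Delta',x:A\vdash Q::\Lambda'$ $\Rightarrow$ $\Gamma;\Delta,\Delta'\vdash(\nu x)(P|Q)::\Lambda,\Lambda'$. - Cut L: $\Gamma;\Delta,x:A\vdash P::\Lambda$ and $\Gamma;\Delta',x:A^\perp\vdash Q::\Lambda'$ $\Rightarrow$ $\Gamma;\Delta,\Delta'\vdash(\nu x)(P|Q)::\Lambda,\Lambda'$. - $\ast$ Cut! R: $\Gamma;\cdot\vdash P::y:A$ and $\Gamma,u:A;\Delta\vdash Q::\Lambda$ $\Rightarrow$ $\Gamma;\Delta\vdash(\nu u)(!u(y).P\,|\,Q)::\Lambda$. - Cut! L: $\Gamma;y:A^\perp\vdash P::\cdot$ and $\Gamma,u:A;\Delta\vdash Q::\Lambda$ $\Rightarrow$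 $\Gamma;\Delta\vdash(\nu u)(!u(y).P\,|\,Q)::\Lambda$. - $\ast$ Copy L: $\Gamma,u:A;\Delta,y:A\vdash P::\Lambda$ $\Rightarrow$ $\Gamma,u:A;\Delta\vdash(\nu y)u\langle y\rangle.P::\Lambda$. - Copy R: $\Gamma,u:A;\Delta\vdash P::\Lambda,y:A^\perp$ $\Rightarrow$ $\Gamma,u:A;\Delta\vdash(\nu y)u\langle y\rangle.P::\Lambda$. - $\ast$ $\mathbf 1$R: $\Gamma;\cdot\vdash x\langle\rangle.\mathbf 0::x:\mathbf 1$. - $\ast$ $\mathbf 1$L: $\Gamma;\Delta\vdash P::\Lambda$ $\Rightarrow$ $\Gamma;\Delta,x:\mathbf 1\vdash x().P::\Lambda$. - $\bot$R: $\Gamma;\Delta\vdash P::\Lambda$ $\Rightarrow$ $\Gamma;\Delta\vdash x().P::\Lambda,x:\bot$. - $\bot$L: $\Gamma;x:\bot\vdash x\langle\rangle.\mathbf 0::\cdot$. - $\ast$ $\otimes$R: $\Gamma;\Delta\vdash P::\Lambda,y:A$ and $\Gamma;\Delta'\vdash Q::\Lambda',x:B$ $\Rightarrow$ $\Gamma;\Delta,\Delta'\vdash(\nu y)x\langle y\rangle.(P|Q)::\Lambda,\Lambda',x:A\otimes B$. - $\ast$ $\otimes$L: $\Gamma;\Delta,y:A,x:B\vdash P::\Lambda$ $\Rightarrow$ $\Gamma;\Delta,x:A\otimes B\vdash x(y).P::\Lambda$. - $⅋$R: $\Gamma;\Delta\vdash P::\Lambda,y:A,x:B$ $\Rightarrow$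 $\Gamma;\Delta\vdash x(y).P::\Lambda,x:A⅋B$. - $⅋$L: $\Gamma;\Delta,y:A\vdash P::\Lambda$ and $\Gamma;\Delta',x:B\vdash Q::\Lambda'$ $\Rightarrow$ $\Gamma;\Delta,\Delta',x:A⅋B\vdash(\nu y)x\langle y\rangle.(P|Q)::\Lambda,\Lambda'$. - $\ast$ $\multimap$R: $\Gamma;\Delta,y:A\vdash P::\Lambda,x:B$ $\Rightarrow$ $\Gamma;\Delta\vdash x(y).P::\Lambda,x:A\multimap B$. - $\ast$ $\multimap$L: $\Gamma;\Delta\vdash P::\Lambda,y:A$ and $\Gamma;\Delta',x:B\vdash Q::\Lambda'$ $\Rightarrow$ $\Gamma;\Delta,\Delta',x:A\multimap B\vdash(\nu y)x\langle y\rangle.(P|Q)::\Lambda,\Lambda'$. - $\ast$ $!$R: $\Gamma;\cdot\vdash P::y:A$ $\Rightarrow$ $\Gamma;\cdot\vdash\ !x(y).P::x:{!}A$. - $\ast$ $!$L: $\Gamma,u:A;\Delta\vdash P::\Lambda$ $\Rightarrow$ $\Gamma;\Delta,x:{!}A\vdash P\{x/u\}::\Lambda$. - $?$R: $\Gamma,u:A;\Delta\vdash P::\Lambda$ $\Rightarrow$ $\Gamma;\Delta\vdash P\{x/u\}::\Lambda,x:{?}A^\perp$. - $?$L: $\Gamma;y:A\vdash P::\cdot$ $\Rightarrow$ $\Gamma;x:{?}A\vdash\ !x(y).P::\cdot$. **System $\pi\mathsf{ILL}$** (judgments $\Gamma;\Delta\vdash_{\mathsf{ILL}}P::z:C$,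 with exactly one assignment on the right; write $\vdash$ for $\vdash_{\mathsf{ILL}}$). Its rules are the $\ast$-marked rules with every sequent having exactly one assignment on the right, namely: - Id: $\Gamma;x:A\vdash[x\leftrightarrow y]::y:A$. - Cut: $\Gamma;\Delta\vdash P::x:A$ and $\Gamma;\Delta',x:A\vdash Q::z:C$ $\Rightarrow$ $\Gamma;\Delta,\Delta'\vdash(\nu x)(P|Q)::z:C$. - Cut!: $\Gamma;\cdot\vdash P::y:A$ and $\Gamma,u:A;\Delta\vdash Q::z:C$ $\Rightarrow$ $\Gamma;\Delta\vdash(\nu u)(!u(y).P\,|\,Q)::z:C$. - Copy: $\Gamma,u:A;\Delta,y:A\vdash P::z:C$ $\Rightarrow$ $\Gamma,u:A;\Delta\vdash(\nu y)u\langle y\rangle.P::z:C$. - $\mathbf 1$R: $\Gamma;\cdot\vdash x\langle\rangle.\mathbf 0::x:\mathbf 1$. - $\mathbf 1$L: $\Gamma;\Delta\vdash P::z:C$ $\Rightarrow$ $\Gamma;\Delta,x:\mathbf 1\vdash x().P::z:C$. - $\otimes$R: $\Gamma;\Delta\vdash P::y:A$ and $\Gamma;\Delta'\vdash Q::x:B$ $\Rightarrow$ $\Gamma;\Delta,\Delta'\vdash(\nu y)x\langle y\rangle.(P|Q)::x:A\otimes B$. - $\otimes$L: $\Gamma;\Delta,y:A,x:B\vdash P::z:C$ $\Rightarrow$ $\Gamma;\Delta,x:A\otimes B\vdash x(y).P::z:C$. - $\multimap$R: $\Gamma;\Delta,y:A\vdash P::x:B$ $\Rightarrow$ $\Gamma;\Delta\vdash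 x(y).P::x:A\multimap B$. - $\multimap$L: $\Gamma;\Delta\vdash P::y:A$ and $\Gamma;\Delta',x:B\vdash Q::z:C$ $\Rightarrow$ $\Gamma;\Delta,\Delta',x:A\multimap B\vdash(\nu y)x\langle y\rangle.(P|Q)::z:C$. - $!$R: $\Gamma;\cdot\vdash P::y:A$ $\Rightarrow$ $\Gamma;\cdot\vdash\ !x(y).P::x:{!}A$. - $!$L: $\Gamma,u:A;\Delta\vdash P::z:C$ $\Rightarrow$ $\Gamma;\Delta,x:{!}A\vdash P\{x/u\}::z:C$. *)

theory Defs
  imports "HOL-Library.Multiset"
begin

section \<open>Types\<close>

datatype tp =
    One ("\<one>")
  | Bot ("\<bottom>")
  | Tensor tp tp (infixr "\<otimes>" 75)
  | Parr tp tp (infixr "\<parr>" 75)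
  | OfCourse tp ("\<^bold>!_" [80] 80)
  | WhyNot tp ("\<^bold>?_" [80] 80)

primrec dual :: "tp \<Rightarrow> tp" ("_\<^sup>\<bottom>" [1000] 1000) where
  "\<one>\<^sup>\<bottom> = \<bottom>"
| "\<bottom>\<^sup>\<bottom> = \<one>"
| "(A \<otimes> B)\<^sup>\<bottom> = A\<^sup>\<bottom> \<parr> B\<^sup>\<bottom>"
| "(A \<parr> B)\<^sup>\<bottom> = A\<^sup>\<bottom> \<otimes> B\<^sup>\<bottom>"
| "(\<^bold>!A)\<^sup>\<bottom> = \<^bold>?(A\<^sup>\<bottom>)"
| "(\<^bold>?A)\<^sup>\<bottom> = \<^bold>!(A\<^sup>\<bottom>)"

text \<open>Linear implication is not a separate constructor: it is identified with
  \<open>A\<^sup>\<bottom> \<parr> B\<close>.\<close>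

abbreviation Lolli :: "tp \<Rightarrow> tp \<Rightarrow> tp" (infixr "\<multimap>" 74) where
  "A \<multimap> B \<equiv> A\<^sup>\<bottom> \<parr> B"

lemma dual_dual [simp]: "A\<^sup>\<bottom>\<^sup>\<bottom> = A"
  by (induction A) auto


section \<open>Processes\<close>

type_synonym name = nat

text \<open>Concrete syntax trees, before \<open>\<alpha>\<close>-conversion:
  \<open>RNu x P\<close> is \<open>(\<nu>x)P\<close>, \<open>ROut x y P\<close> is \<open>x\<langle>y\<rangle>.P\<close>,
  \<open>RIn x y P\<close> is \<open>x(y).P\<close>, \<open>RSrv x y P\<close> is \<open>!x(y).P\<close>,
  \<open>RClose x\<close> is \<open>x\<langle>\<rangle>.0\<close>, \<open>RWait x P\<close> is \<open>x().P\<close>.\<close>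

datatype raw =
    RInact
  | RFwd name name
  | RNu name raw
  | RPar raw raw
  | ROut name name raw
  | RIn name name raw
  | RSrv name name raw
  | RClose name
  | RWait name raw

primrec raw_fn :: "raw \<Rightarrow> name set" where
  "raw_fn RInact = {}"
| "raw_fn (RFwd x y) = {x, y}"
| "raw_fn (RNu x P) = raw_fn P - {x}"
| "raw_fn (RPar P Q) = raw_fn P \<union> raw_fn Q"
| "raw_fn (ROut x y P) = {x, y} \<union> raw_fn P"
| "raw_fn (RIn x y P) = {x} \<union> (raw_fn P - {y})"
| "raw_fn (RSrv x y P) = {x} \<union> (raw_fn P - {y})"
| "raw_fn (RClose x) = {x}"
| "raw_fn (RWait x P) = {x} \<union> raw_fn P"

lemma finite_raw_fn [simp]: "finite (raw_fn P)"
  by (induction P) auto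

definition fresh :: "name set \<Rightarrow> name" where
  "fresh S = (LEAST n. n \<notin> S)"

lemma fresh_notin: "finite S \<Longrightarrow> fresh S \<notin> S"
  unfolding fresh_def using ex_new_if_finite[OF infinite_UNIV_nat, of S] by (metis LeastI)

text \<open>Capture-avoiding simultaneous renaming of the free names by \<open>f\<close>. Every binder
  is renamed to a name that depends only on the set of names it must avoid, so that
  \<open>\<alpha>\<close>-equivalent arguments are sent to equal results (Stoughton, ``Substitution
  revisited'').\<close>

primrec rename :: "(name \<Rightarrow> name) \<Rightarrow> raw \<Rightarrow> raw" where
  "rename f RInact = RInact"
| "rename f (RFwd x y) = RFwd (f x) (f y)"
| "rename f (RNu x P) =
    (let x' = fresh (f ` (raw_fn P - {x})) in RNu x' (rename (f(x := x')) P))"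
| "rename f (RPar P Q) = RPar (rename f P) (rename f Q)"
| "rename f (ROut x y P) = ROut (f x) (f y) (rename f P)"
| "rename f (RIn x y P) =
    (let y' = fresh (f ` (raw_fn P - {y})) in RIn (f x) y' (rename (f(y := y')) P))"
| "rename f (RSrv x y P) =
    (let y' = fresh (f ` (raw_fn P - {y})) in RSrv (f x) y' (rename (f(y := y')) P))"
| "rename f (RClose x) = RClose (f x)"
| "rename f (RWait x P) = RWait (f x) (rename f P)"

text \<open>\<open>raw_subst P y x\<close> is \<open>P{y/x}\<close>.\<close>

definition raw_subst :: "raw \<Rightarrow> name \<Rightarrow> name \<Rightarrow> raw" where
  "raw_subst P y x = rename (id(x := y)) P"

text \<open>\<open>\<alpha>\<close>-equivalence: the least congruence containing the renaming of bound names.\<close>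

inductive alpha :: "raw \<Rightarrow> raw \<Rightarrow> bool" where
  alpha_refl: "alpha P P"
| alpha_sym: "alpha P Q \<Longrightarrow> alpha Q P"
| alpha_trans: "alpha P Q \<Longrightarrow> alpha Q R \<Longrightarrow> alpha P R"
| alpha_Nu: "y \<notin> raw_fn P - {x} \<Longrightarrow> alpha (RNu x P) (RNu y (raw_subst P y x))"
| alpha_In: "y \<notin> raw_fn P - {x} \<Longrightarrow> alpha (RIn z x P) (RIn z y (raw_subst P y x))"
| alpha_Srv: "y \<notin> raw_fn P - {x} \<Longrightarrow> alpha (RSrv z x P) (RSrv z y (raw_subst P y x))"
| cong_Nu: "alpha P P' \<Longrightarrow> alpha (RNu x P) (RNu x P')"
| cong_Par: "alpha P P' \<Longrightarrow> alpha Q Q' \<Longrightarrow> alpha (RPar P Q) (RPar P' Q')"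
| cong_Out: "alpha P P' \<Longrightarrow> alpha (ROut x y P) (ROut x y P')"
| cong_In: "alpha P P' \<Longrightarrow> alpha (RIn x y P) (RIn x y P')"
| cong_Srv: "alpha P P' \<Longrightarrow> alpha (RSrv x y P) (RSrv x y P')"
| cong_Wait: "alpha P P' \<Longrightarrow> alpha (RWait x P) (RWait x P')"

lemma raw_fn_rename_binder:
  assumes "a \<notin> f ` (S - {x})"
  shows "f(x := a) ` S - {a} = f ` (S - {x})"
  using assms by (auto split: if_splits)

lemma raw_fn_rename [simp]: "raw_fn (rename f P) = f ` raw_fn P"
proof (induction P arbitrary: f)
  case (RNu x P)
  have b: "fresh (f ` (raw_fn P - {x})) \<notin> f ` (raw_fn P - {x})"
    by (rule fresh_notin) simp
  show ?case
    by (simp only: rename.simps Let_def raw_fn.simps RNu raw_fn_rename_binder[OF b])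
next
  case (RIn z x P)
  have b: "fresh (f ` (raw_fn P - {x})) \<notin> f ` (raw_fn P - {x})"
    by (rule fresh_notin) simp
  show ?case
    by (simp only: rename.simps Let_def raw_fn.simps RIn raw_fn_rename_binder[OF b]
        image_Un image_insert image_empty)
next
  case (RSrv z x P)
  have b: "fresh (f ` (raw_fn P - {x})) \<notin> f ` (raw_fn P - {x})"
    by (rule fresh_notin) simp
  show ?case
    by (simp only: rename.simps Let_def raw_fn.simps RSrv raw_fn_rename_binder[OF b]
        image_Un image_insert image_empty)
qed auto

lemma rename_cong: "(\<And>x. x \<in> raw_fn P \<Longrightarrow> f x = g x) \<Longrightarrow> rename f P = rename g P"
proof (induction P arbitrary: f g)
  case (RNu x P)
  have "f ` (raw_fn P - {x}) = g ` (raw_fn P - {x})"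
    using RNu.prems by (auto intro!: image_cong)
  moreover have "rename (f(x := a)) P = rename (g(x := a)) P" for a
    by (rule RNu.IH) (use RNu.prems in auto)
  ultimately show ?case by (simp add: Let_def)
next
  case (RIn z x P)
  have "f ` (raw_fn P - {x}) = g ` (raw_fn P - {x})"
    using RIn.prems by (auto intro!: image_cong)
  moreover have "rename (f(x := a)) P = rename (g(x := a)) P" for a
    by (rule RIn.IH) (use RIn.prems in auto)
  ultimately show ?case using RIn.prems by (simp add: Let_def)
next
  case (RSrv z x P)
  have "f ` (raw_fn P - {x}) = g ` (raw_fn P - {x})"
    using RSrv.prems by (auto intro!: image_cong)
  moreover have "rename (f(x := a)) P = rename (g(x := a)) P" for a
    by (rule RSrv.IH) (use RSrv.prems in auto)
  ultimately show ?case using RSrv.prems by (simp add: Let_def)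
next
  case (RPar P Q)
  then show ?case by (metis UnCI raw_fn.simps(4) rename.simps(4))
next
  case (ROut x y P)
  then show ?case by (metis UnCI insertCI raw_fn.simps(5) rename.simps(5))
next
  case (RWait x P)
  then show ?case by (metis UnCI insertCI raw_fn.simps(9) rename.simps(9))
qed auto

lemma fresh_upd_eq:
  assumes "b \<notin> g ` (raw_fn P - {x})" "w \<in> raw_fn P"
  shows "(f(b := c) \<circ> g(x := b)) w = ((f \<circ> g)(x := c)) w"
  using assms by auto

lemma rename_rename: "rename f (rename g P) = rename (f \<circ> g) P"
proof (induction P arbitrary: f g)
  case (RNu x P)
  let ?b = "fresh (g ` (raw_fn P - {x}))"
  have b: "?b \<notin> g ` (raw_fn P - {x})" by (rule fresh_notin) simp
  have "rename (f(?b := c) \<circ> g(x := ?b)) P = rename ((f \<circ> g)(x := c)) P" for c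
    by (rule rename_cong, rule fresh_upd_eq[OF b])
  then show ?case
    by (simp only: rename.simps Let_def RNu raw_fn_rename raw_fn_rename_binder[OF b] image_comp)
next
  case (RIn z x P)
  let ?b = "fresh (g ` (raw_fn P - {x}))"
  have b: "?b \<notin> g ` (raw_fn P - {x})" by (rule fresh_notin) simp
  have "rename (f(?b := c) \<circ> g(x := ?b)) P = rename ((f \<circ> g)(x := c)) P" for c
    by (rule rename_cong, rule fresh_upd_eq[OF b])
  then show ?case
    by (simp only: rename.simps Let_def RIn raw_fn_rename raw_fn_rename_binder[OF b] image_comp)
      (simp only: comp_apply)
next
  case (RSrv z x P)
  let ?b = "fresh (g ` (raw_fn P - {x}))"
  have b: "?b \<notin> g ` (raw_fn P - {x})" by (rule fresh_notin) simp
  have "rename (f(?b := c) \<circ> g(x := ?b)) P = rename ((f \<circ> g)(x := c)) P" for c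
    by (rule rename_cong, rule fresh_upd_eq[OF b])
  then show ?case
    by (simp only: rename.simps Let_def RSrv raw_fn_rename raw_fn_rename_binder[OF b] image_comp)
      (simp only: comp_apply)
qed auto

lemma raw_fn_subst_binder:
  "y \<notin> raw_fn P - {x} \<Longrightarrow> raw_fn (raw_subst P y x) - {y} = raw_fn P - {x}"
  using raw_fn_rename_binder[of y id "raw_fn P" x] by (simp add: raw_subst_def del: fun_upd_apply)

lemma rename_subst_binder:
  assumes "y \<notin> raw_fn P - {x}"
  shows "rename (f(y := c)) (raw_subst P y x) = rename (f(x := c)) P"
  unfolding raw_subst_def rename_rename
  by (rule rename_cong) (use assms in auto)

lemma alpha_raw_fn: "alpha P Q \<Longrightarrow> raw_fn P = raw_fn Q"
  by (induction rule: alpha.induct) (auto simp del: raw_fn_rename simp: raw_fn_subst_binder)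

lemma alpha_rename_eq: "alpha P Q \<Longrightarrow> rename f P = rename f Q"
proof (induction arbitrary: f rule: alpha.induct)
  case (cong_Nu P P' x)
  then show ?case using alpha_raw_fn[OF cong_Nu.hyps] by (simp add: Let_def del: fun_upd_apply)
next
  case (cong_In P P' x y)
  then show ?case using alpha_raw_fn[OF cong_In.hyps] by (simp add: Let_def del: fun_upd_apply)
next
  case (cong_Srv P P' x y)
  then show ?case using alpha_raw_fn[OF cong_Srv.hyps] by (simp add: Let_def del: fun_upd_apply)
qed (simp_all add: Let_def raw_fn_subst_binder rename_subst_binder)

lemma alpha_rename_id: "alpha (rename id P) P"
proof (induction P)
  case (RNu x P)
  have "fresh (raw_fn P - {x}) \<notin> raw_fn P - {x}" by (rule fresh_notin) simp
  from alpha_sym[OF alpha_Nu[OF this]] show ?case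
    by (simp only: rename.simps Let_def raw_subst_def image_id id_apply[of "raw_fn P - {x}"])
next
  case (RIn z x P)
  have "fresh (raw_fn P - {x}) \<notin> raw_fn P - {x}" by (rule fresh_notin) simp
  from alpha_sym[OF alpha_In[OF this]] show ?case
    by (simp only: rename.simps Let_def raw_subst_def image_id id_apply[of "raw_fn P - {x}"]
        id_apply[of z])
next
  case (RSrv z x P)
  have "fresh (raw_fn P - {x}) \<notin> raw_fn P - {x}" by (rule fresh_notin) simp
  from alpha_sym[OF alpha_Srv[OF this]] show ?case
    by (simp only: rename.simps Let_def raw_subst_def image_id id_apply[of "raw_fn P - {x}"]
        id_apply[of z])
qed (auto intro: alpha.intros)

lemma alpha_iff: "alpha P Q \<longleftrightarrow> rename id P = rename id Q"
  by (metis alpha_rename_eq alpha_rename_id alpha_sym alpha_trans)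

lemma equivp_alpha: "equivp alpha"
  by (rule equivpI) (auto intro: reflpI sympI transpI alpha.intros(1-3))

quotient_type proc = raw / alpha
  by (rule equivp_alpha)

lift_definition Inact :: proc is RInact .
lift_definition Fwd :: "name \<Rightarrow> name \<Rightarrow> proc" ("[_\<leftrightarrow>_]") is RFwd .
lift_definition Nu :: "name \<Rightarrow> proc \<Rightarrow> proc" ("'(\<nu>_') _" [0, 70] 70) is RNu
  by (rule cong_Nu)
lift_definition ParComp :: "proc \<Rightarrow> proc \<Rightarrow> proc" (infixr "\<parallel>" 65) is RPar
  by (rule cong_Par)
lift_definition Out :: "name \<Rightarrow> name \<Rightarrow> proc \<Rightarrow> proc" ("_\<langle>_\<rangle>\<cdot>_" [1000, 0, 70] 70) is ROut
  by (rule cong_Out)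
lift_definition In :: "name \<Rightarrow> name \<Rightarrow> proc \<Rightarrow> proc" ("_'\<lparr>_'\<rparr>\<cdot>_" [1000, 0, 70] 70) is RIn
  by (rule cong_In)
lift_definition Srv :: "name \<Rightarrow> name \<Rightarrow> proc \<Rightarrow> proc" ("\<^bold>!_'\<lparr>_'\<rparr>\<cdot>_" [1000, 0, 70] 70) is RSrv
  by (rule cong_Srv)
lift_definition Close :: "name \<Rightarrow> proc" ("_\<langle>\<rangle>" [1000] 1000) is RClose .
lift_definition Wait :: "name \<Rightarrow> proc \<Rightarrow> proc" ("_'\<lparr>'\<rparr>\<cdot>_" [1000, 70] 70) is RWait
  by (rule cong_Wait)

lift_definition fn :: "proc \<Rightarrow> name set" is raw_fn
  by (rule alpha_raw_fn)

lift_definition subst :: "proc \<Rightarrow> name \<Rightarrow> name \<Rightarrow> proc" ("_\<lbrace>_'/_\<rbrace>" [1000, 0, 0] 1000) is raw_subst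
  by (simp add: raw_subst_def alpha_rename_eq alpha_refl)

lemma Nu_rename: "y \<notin> fn P - {x} \<Longrightarrow> (\<nu>x) P = (\<nu>y) (P\<lbrace>y/x\<rbrace>)"
  by transfer (rule alpha_Nu)

lemma In_rename: "y \<notin> fn P - {x} \<Longrightarrow> z\<lparr>x\<rparr>\<cdot>P = z\<lparr>y\<rparr>\<cdot>(P\<lbrace>y/x\<rbrace>)"
  by transfer (rule alpha_In)

lemma Srv_rename: "y \<notin> fn P - {x} \<Longrightarrow> \<^bold>!z\<lparr>x\<rparr>\<cdot>P = \<^bold>!z\<lparr>y\<rparr>\<cdot>(P\<lbrace>y/x\<rbrace>)"
  by transfer (rule alpha_Srv)

lemma raw_subst_binder:
  assumes "z \<noteq> x" "z \<noteq> y"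
  shows "alpha (raw_subst (RNu z P) y x) (RNu z (raw_subst P y x))"
    and "alpha (raw_subst (RIn w z P) y x) (RIn (if w = x then y else w) z (raw_subst P y x))"
    and "alpha (raw_subst (RSrv w z P) y x) (RSrv (if w = x then y else w) z (raw_subst P y x))"
proof -
  let ?g = "id(x := y)"
  let ?b = "fresh (?g ` (raw_fn P - {z}))"
  have b: "?b \<notin> ?g ` (raw_fn P - {z})" by (rule fresh_notin) simp
  have "?g ` raw_fn P - {z} \<subseteq> ?g ` (raw_fn P - {z})" using assms by auto
  then have c: "?b \<notin> raw_fn (raw_subst P y x) - {z}" using b by (auto simp: raw_subst_def)
  have eq: "raw_subst (raw_subst P y x) ?b z = rename (?g(z := ?b)) P"
    unfolding raw_subst_def rename_rename by (rule rename_cong) (use assms in auto)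
  show "alpha (raw_subst (RNu z P) y x) (RNu z (raw_subst P y x))"
    using alpha_sym[OF alpha_Nu[OF c]] unfolding eq by (simp add: raw_subst_def Let_def)
  show "alpha (raw_subst (RIn w z P) y x) (RIn (if w = x then y else w) z (raw_subst P y x))"
    using alpha_sym[OF alpha_In[OF c]] unfolding eq by (simp add: raw_subst_def Let_def)
  show "alpha (raw_subst (RSrv w z P) y x) (RSrv (if w = x then y else w) z (raw_subst P y x))"
    using alpha_sym[OF alpha_Srv[OF c]] unfolding eq by (simp add: raw_subst_def Let_def)
qed

lemma subst_simps:
  "Inact\<lbrace>y/x\<rbrace> = Inact"
  "[v\<leftrightarrow>w]\<lbrace>y/x\<rbrace> = [(if v = x then y else v)\<leftrightarrow>(if w = x then y else w)]"
  "(P \<parallel> Q)\<lbrace>y/x\<rbrace> = (P\<lbrace>y/x\<rbrace>) \<parallel> (Q\<lbrace>y/x\<rbrace>)"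
  "(v\<langle>w\<rangle>\<cdot>P)\<lbrace>y/x\<rbrace> = (if v = x then y else v)\<langle>if w = x then y else w\<rangle>\<cdot>(P\<lbrace>y/x\<rbrace>)"
  "(v\<langle>\<rangle>)\<lbrace>y/x\<rbrace> = (if v = x then y else v)\<langle>\<rangle>"
  "(v\<lparr>\<rparr>\<cdot>P)\<lbrace>y/x\<rbrace> = (if v = x then y else v)\<lparr>\<rparr>\<cdot>(P\<lbrace>y/x\<rbrace>)"
  by (transfer; simp add: raw_subst_def alpha_refl)+

lemma subst_binder:
  "z \<noteq> x \<Longrightarrow> z \<noteq> y \<Longrightarrow> ((\<nu>z) P)\<lbrace>y/x\<rbrace> = (\<nu>z) (P\<lbrace>y/x\<rbrace>)"
  "z \<noteq> x \<Longrightarrow> z \<noteq> y \<Longrightarrow> (v\<lparr>z\<rparr>\<cdot>P)\<lbrace>y/x\<rbrace> = (if v = x then y else v)\<lparr>z\<rparr>\<cdot>(P\<lbrace>y/x\<rbrace>)"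
  "z \<noteq> x \<Longrightarrow> z \<noteq> y \<Longrightarrow> (\<^bold>!v\<lparr>z\<rparr>\<cdot>P)\<lbrace>y/x\<rbrace> = \<^bold>!(if v = x then y else v)\<lparr>z\<rparr>\<cdot>(P\<lbrace>y/x\<rbrace>)"
  by (transfer; rule raw_subst_binder; assumption)+

lemma fn_simps [simp]:
  "fn Inact = {}"
  "fn [x\<leftrightarrow>y] = {x, y}"
  "fn ((\<nu>x) P) = fn P - {x}"
  "fn (P \<parallel> Q) = fn P \<union> fn Q"
  "fn (x\<langle>y\<rangle>\<cdot>P) = {x, y} \<union> fn P"
  "fn (x\<lparr>y\<rparr>\<cdot>P) = {x} \<union> (fn P - {y})"
  "fn (\<^bold>!x\<lparr>y\<rparr>\<cdot>P) = {x} \<union> (fn P - {y})"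
  "fn (x\<langle>\<rangle>) = {x}"
  "fn (x\<lparr>\<rparr>\<cdot>P) = {x} \<union> fn P"
  by (transfer, simp)+


section \<open>Contexts\<close>

text \<open>A comma between contexts is multiset sum. That the names in a context are pairwise
  distinct, and hence that commas are disjoint unions, is the predicate \<open>distinct_names\<close>;
  it is required of the three zones of a sequent taken together.\<close>

type_synonym ctx = "(name \<times> tp) multiset"

definition names :: "ctx \<Rightarrow> name set" where
  "names \<Delta> = fst ` set_mset \<Delta>"

definition distinct_names :: "ctx \<Rightarrow> bool" where
  "distinct_names \<Delta> \<longleftrightarrow> (\<forall>x. count (image_mset fst \<Delta>) x \<le> 1)"

abbreviation extend :: "ctx \<Rightarrow> name \<Rightarrow> tp \<Rightarrow> ctx" ("_,, _ \<^bold>: _" [61, 62, 62] 61) where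
  "\<Delta>,, x \<^bold>: A \<equiv> add_mset (x, A) \<Delta>"

lemma names_simps [simp]:
  "names {#} = {}"
  "names (\<Delta>,, x \<^bold>: A) = insert x (names \<Delta>)"
  "names (\<Delta> + \<Delta>') = names \<Delta> \<union> names \<Delta>'"
  by (auto simp: names_def)

lemma count_names_eq_0: "count (image_mset fst \<Delta>) x = 0 \<longleftrightarrow> x \<notin> names \<Delta>"
  by (auto simp: names_def count_eq_zero_iff)

lemma distinct_names_simps [simp]:
  "distinct_names {#}"
  "distinct_names (\<Delta>,, x \<^bold>: A) \<longleftrightarrow> x \<notin> names \<Delta> \<and> distinct_names \<Delta>"
proof -
  show "distinct_names {#}" by (simp add: distinct_names_def)
  show "distinct_names (\<Delta>,, x \<^bold>: A) \<longleftrightarrow> x \<notin> names \<Delta> \<and> distinct_names \<Delta>"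
  proof
    assume d: "distinct_names (\<Delta>,, x \<^bold>: A)"
    have "count (image_mset fst \<Delta>) z \<le> 1" for z
      using d[unfolded distinct_names_def, rule_format, of z] by (simp split: if_splits)
    moreover have "count (image_mset fst \<Delta>) x = 0"
      using d[unfolded distinct_names_def, rule_format, of x] by simp
    ultimately show "x \<notin> names \<Delta> \<and> distinct_names \<Delta>"
      by (simp add: distinct_names_def count_names_eq_0)
  next
    assume "x \<notin> names \<Delta> \<and> distinct_names \<Delta>"
    then show "distinct_names (\<Delta>,, x \<^bold>: A)"
      by (simp add: distinct_names_def flip: count_names_eq_0)
  qed
qed

lemma distinct_names_union:
  "distinct_names (\<Delta> + \<Delta>') \<longleftrightarrow>
    distinct_names \<Delta> \<and> distinct_names \<Delta>' \<and> names \<Delta> \<inter> names \<Delta>' = {}"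
  by (induction \<Delta>) auto


section \<open>The type systems\<close>

text \<open>The condition \<open>distinct_names\<close> appears only in the rules whose conclusion does not
  inherit it from the premises; see \<open>ull_distinct\<close> and \<open>ill_distinct\<close>. In the
  rules that type a bound output \<open>(\<nu>y)x\<langle>y\<rangle>.(P|Q)\<close>, where \<open>y\<close> belongs to
  the sequent of \<open>P\<close> only, the usual convention that bound names differ from the names of
  the conclusion is an explicit side condition; without it \<open>\<nu>y\<close> could capture a free
  name of \<open>Q\<close>. In the other rules this follows from distinctness in the premises, or does
  not matter because the bound name scopes over the typed premise alone.\<close>

inductive ull :: "ctx \<Rightarrow> ctx \<Rightarrow> proc \<Rightarrow> ctx \<Rightarrow> bool" ("_ \<Zsemi> _ \<turnstile> _ \<Colon> _" [51, 51, 51, 51] 50) where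
  IdR: "distinct_names (\<Gamma>,, x \<^bold>: A,, y \<^bold>: A) \<Longrightarrow>
    \<Gamma> \<Zsemi> {#},, x \<^bold>: A \<turnstile> [x\<leftrightarrow>y] \<Colon> {#},, y \<^bold>: A"
| IdL: "distinct_names (\<Gamma>,, x \<^bold>: A,, y \<^bold>: A\<^sup>\<bottom>) \<Longrightarrow>
    \<Gamma> \<Zsemi> {#},, x \<^bold>: A,, y \<^bold>: A\<^sup>\<bottom> \<turnstile> [x\<leftrightarrow>y] \<Colon> {#}"
| CutR: "\<Gamma> \<Zsemi> \<Delta> \<turnstile> P \<Colon> \<Lambda>,, x \<^bold>: A \<Longrightarrow> \<Gamma> \<Zsemi> \<Delta>',, x \<^bold>: A \<turnstile> Q \<Colon> \<Lambda>' \<Longrightarrow>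
    distinct_names (\<Gamma> + \<Delta> + \<Delta>' + \<Lambda> + \<Lambda>') \<Longrightarrow>
    \<Gamma> \<Zsemi> \<Delta> + \<Delta>' \<turnstile> (\<nu>x) (P \<parallel> Q) \<Colon> \<Lambda> + \<Lambda>'"
| CutL: "\<Gamma> \<Zsemi> \<Delta>,, x \<^bold>: A \<turnstile> P \<Colon> \<Lambda> \<Longrightarrow> \<Gamma> \<Zsemi> \<Delta>',, x \<^bold>: A\<^sup>\<bottom> \<turnstile> Q \<Colon> \<Lambda>' \<Longrightarrow>
    distinct_names (\<Gamma> + \<Delta> + \<Delta>' + \<Lambda> + \<Lambda>') \<Longrightarrow>
    \<Gamma> \<Zsemi> \<Delta> + \<Delta>' \<turnstile> (\<nu>x) (P \<parallel> Q) \<Colon> \<Lambda> + \<Lambda>'"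
| CutBangR: "\<Gamma> \<Zsemi> {#} \<turnstile> P \<Colon> {#},, y \<^bold>: A \<Longrightarrow> \<Gamma>,, u \<^bold>: A \<Zsemi> \<Delta> \<turnstile> Q \<Colon> \<Lambda> \<Longrightarrow>
    \<Gamma> \<Zsemi> \<Delta> \<turnstile> (\<nu>u) (\<^bold>!u\<lparr>y\<rparr>\<cdot>P \<parallel> Q) \<Colon> \<Lambda>"
| CutBangL: "\<Gamma> \<Zsemi> {#},, y \<^bold>: A\<^sup>\<bottom> \<turnstile> P \<Colon> {#} \<Longrightarrow> \<Gamma>,, u \<^bold>: A \<Zsemi> \<Delta> \<turnstile> Q \<Colon> \<Lambda> \<Longrightarrow>
    \<Gamma> \<Zsemi> \<Delta> \<turnstile> (\<nu>u) (\<^bold>!u\<lparr>y\<rparr>\<cdot>P \<parallel> Q) \<Colon> \<Lambda>"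
| CopyL: "\<Gamma>,, u \<^bold>: A \<Zsemi> \<Delta>,, y \<^bold>: A \<turnstile> P \<Colon> \<Lambda> \<Longrightarrow>
    \<Gamma>,, u \<^bold>: A \<Zsemi> \<Delta> \<turnstile> (\<nu>y) u\<langle>y\<rangle>\<cdot>P \<Colon> \<Lambda>"
| CopyR: "\<Gamma>,, u \<^bold>: A \<Zsemi> \<Delta> \<turnstile> P \<Colon> \<Lambda>,, y \<^bold>: A\<^sup>\<bottom> \<Longrightarrow>
    \<Gamma>,, u \<^bold>: A \<Zsemi> \<Delta> \<turnstile> (\<nu>y) u\<langle>y\<rangle>\<cdot>P \<Colon> \<Lambda>"
| OneR: "distinct_names (\<Gamma>,, x \<^bold>: \<one>) \<Longrightarrow>
    \<Gamma> \<Zsemi> {#} \<turnstile> x\<langle>\<rangle> \<Colon> {#},, x \<^bold>: \<one>"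
| OneL: "\<Gamma> \<Zsemi> \<Delta> \<turnstile> P \<Colon> \<Lambda> \<Longrightarrow> distinct_names (\<Gamma> + \<Delta> + \<Lambda>,, x \<^bold>: \<one>) \<Longrightarrow>
    \<Gamma> \<Zsemi> \<Delta>,, x \<^bold>: \<one> \<turnstile> x\<lparr>\<rparr>\<cdot>P \<Colon> \<Lambda>"
| BotR: "\<Gamma> \<Zsemi> \<Delta> \<turnstile> P \<Colon> \<Lambda> \<Longrightarrow> distinct_names (\<Gamma> + \<Delta> + \<Lambda>,, x \<^bold>: \<bottom>) \<Longrightarrow>
    \<Gamma> \<Zsemi> \<Delta> \<turnstile> x\<lparr>\<rparr>\<cdot>P \<Colon> \<Lambda>,, x \<^bold>: \<bottom>"
| BotL: "distinct_names (\<Gamma>,, x \<^bold>: \<bottom>) \<Longrightarrow>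
    \<Gamma> \<Zsemi> {#},, x \<^bold>: \<bottom> \<turnstile> x\<langle>\<rangle> \<Colon> {#}"
| TensorR: "\<Gamma> \<Zsemi> \<Delta> \<turnstile> P \<Colon> \<Lambda>,, y \<^bold>: A \<Longrightarrow> \<Gamma> \<Zsemi> \<Delta>' \<turnstile> Q \<Colon> \<Lambda>',, x \<^bold>: B \<Longrightarrow>
    distinct_names (\<Gamma> + \<Delta> + \<Delta>' + \<Lambda> + \<Lambda>',, x \<^bold>: A \<otimes> B) \<Longrightarrow>
    y \<notin> insert x (names (\<Delta>' + \<Lambda>')) \<Longrightarrow>
    \<Gamma> \<Zsemi> \<Delta> + \<Delta>' \<turnstile> (\<nu>y) x\<langle>y\<rangle>\<cdot>(P \<parallel> Q) \<Colon> \<Lambda> + \<Lambda>',, x \<^bold>: A \<otimes> B"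
| TensorL: "\<Gamma> \<Zsemi> \<Delta>,, y \<^bold>: A,, x \<^bold>: B \<turnstile> P \<Colon> \<Lambda> \<Longrightarrow>
    \<Gamma> \<Zsemi> \<Delta>,, x \<^bold>: A \<otimes> B \<turnstile> x\<lparr>y\<rparr>\<cdot>P \<Colon> \<Lambda>"
| ParR: "\<Gamma> \<Zsemi> \<Delta> \<turnstile> P \<Colon> \<Lambda>,, y \<^bold>: A,, x \<^bold>: B \<Longrightarrow>
    \<Gamma> \<Zsemi> \<Delta> \<turnstile> x\<lparr>y\<rparr>\<cdot>P \<Colon> \<Lambda>,, x \<^bold>: A \<parr> B"
| ParL: "\<Gamma> \<Zsemi> \<Delta>,, y \<^bold>: A \<turnstile> P \<Colon> \<Lambda> \<Longrightarrow> \<Gamma> \<Zsemi> \<Delta>',, x \<^bold>: B \<turnstile> Q \<Colon> \<Lambda>' \<Longrightarrow>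
    distinct_names (\<Gamma> + \<Delta> + \<Delta>' + \<Lambda> + \<Lambda>',, x \<^bold>: A \<parr> B) \<Longrightarrow>
    y \<notin> insert x (names (\<Delta>' + \<Lambda>')) \<Longrightarrow>
    \<Gamma> \<Zsemi> \<Delta> + \<Delta>',, x \<^bold>: A \<parr> B \<turnstile> (\<nu>y) x\<langle>y\<rangle>\<cdot>(P \<parallel> Q) \<Colon> \<Lambda> + \<Lambda>'"
| LolliR: "\<Gamma> \<Zsemi> \<Delta>,, y \<^bold>: A \<turnstile> P \<Colon> \<Lambda>,, x \<^bold>: B \<Longrightarrow>
    \<Gamma> \<Zsemi> \<Delta> \<turnstile> x\<lparr>y\<rparr>\<cdot>P \<Colon> \<Lambda>,, x \<^bold>: A \<multimap> B"
| LolliL: "\<Gamma> \<Zsemi> \<Delta> \<turnstile> P \<Colon> \<Lambda>,, y \<^bold>: A \<Longrightarrow> \<Gamma> \<Zsemi> \<Delta>',, x \<^bold>: B \<turnstile> Q \<Colon> \<Lambda>' \<Longrightarrow>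
    distinct_names (\<Gamma> + \<Delta> + \<Delta>' + \<Lambda> + \<Lambda>',, x \<^bold>: A \<multimap> B) \<Longrightarrow>
    y \<notin> insert x (names (\<Delta>' + \<Lambda>')) \<Longrightarrow>
    \<Gamma> \<Zsemi> \<Delta> + \<Delta>',, x \<^bold>: A \<multimap> B \<turnstile> (\<nu>y) x\<langle>y\<rangle>\<cdot>(P \<parallel> Q) \<Colon> \<Lambda> + \<Lambda>'"
| BangR: "\<Gamma> \<Zsemi> {#} \<turnstile> P \<Colon> {#},, y \<^bold>: A \<Longrightarrow> distinct_names (\<Gamma>,, x \<^bold>: \<^bold>!A) \<Longrightarrow>
    \<Gamma> \<Zsemi> {#} \<turnstile> \<^bold>!x\<lparr>y\<rparr>\<cdot>P \<Colon> {#},, x \<^bold>: \<^bold>!A"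
| BangL: "\<Gamma>,, u \<^bold>: A \<Zsemi> \<Delta> \<turnstile> P \<Colon> \<Lambda> \<Longrightarrow> distinct_names (\<Gamma> + \<Delta> + \<Lambda>,, x \<^bold>: \<^bold>!A) \<Longrightarrow>
    \<Gamma> \<Zsemi> \<Delta>,, x \<^bold>: \<^bold>!A \<turnstile> P\<lbrace>x/u\<rbrace> \<Colon> \<Lambda>"
| WhyNotR: "\<Gamma>,, u \<^bold>: A \<Zsemi> \<Delta> \<turnstile> P \<Colon> \<Lambda> \<Longrightarrow> distinct_names (\<Gamma> + \<Delta> + \<Lambda>,, x \<^bold>: \<^bold>?(A\<^sup>\<bottom>)) \<Longrightarrow>
    \<Gamma> \<Zsemi> \<Delta> \<turnstile> P\<lbrace>x/u\<rbrace> \<Colon> \<Lambda>,, x \<^bold>: \<^bold>?(A\<^sup>\<bottom>)"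
| WhyNotL: "\<Gamma> \<Zsemi> {#},, y \<^bold>: A \<turnstile> P \<Colon> {#} \<Longrightarrow> distinct_names (\<Gamma>,, x \<^bold>: \<^bold>?A) \<Longrightarrow>
    \<Gamma> \<Zsemi> {#},, x \<^bold>: \<^bold>?A \<turnstile> \<^bold>!x\<lparr>y\<rparr>\<cdot>P \<Colon> {#}"

inductive ill :: "ctx \<Rightarrow> ctx \<Rightarrow> proc \<Rightarrow> name \<Rightarrow> tp \<Rightarrow> bool"
    ("_ \<Zsemi> _ \<turnstile>\<^sub>I _ \<Colon> _ \<^bold>: _" [51, 51, 51, 51, 51] 50) where
  Id: "distinct_names (\<Gamma>,, x \<^bold>: A,, y \<^bold>: A) \<Longrightarrow>
    \<Gamma> \<Zsemi> {#},, x \<^bold>: A \<turnstile>\<^sub>I [x\<leftrightarrow>y] \<Colon> y \<^bold>: A"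
| Cut: "\<Gamma> \<Zsemi> \<Delta> \<turnstile>\<^sub>I P \<Colon> x \<^bold>: A \<Longrightarrow> \<Gamma> \<Zsemi> \<Delta>',, x \<^bold>: A \<turnstile>\<^sub>I Q \<Colon> z \<^bold>: C \<Longrightarrow>
    distinct_names (\<Gamma> + \<Delta> + \<Delta>',, z \<^bold>: C) \<Longrightarrow>
    \<Gamma> \<Zsemi> \<Delta> + \<Delta>' \<turnstile>\<^sub>I (\<nu>x) (P \<parallel> Q) \<Colon> z \<^bold>: C"
| CutBang: "\<Gamma> \<Zsemi> {#} \<turnstile>\<^sub>I P \<Colon> y \<^bold>: A \<Longrightarrow> \<Gamma>,, u \<^bold>: A \<Zsemi> \<Delta> \<turnstile>\<^sub>I Q \<Colon> z \<^bold>: C \<Longrightarrow>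
    \<Gamma> \<Zsemi> \<Delta> \<turnstile>\<^sub>I (\<nu>u) (\<^bold>!u\<lparr>y\<rparr>\<cdot>P \<parallel> Q) \<Colon> z \<^bold>: C"
| Copy: "\<Gamma>,, u \<^bold>: A \<Zsemi> \<Delta>,, y \<^bold>: A \<turnstile>\<^sub>I P \<Colon> z \<^bold>: C \<Longrightarrow>
    \<Gamma>,, u \<^bold>: A \<Zsemi> \<Delta> \<turnstile>\<^sub>I (\<nu>y) u\<langle>y\<rangle>\<cdot>P \<Colon> z \<^bold>: C"
| OneR: "distinct_names (\<Gamma>,, x \<^bold>: \<one>) \<Longrightarrow>
    \<Gamma> \<Zsemi> {#} \<turnstile>\<^sub>I x\<langle>\<rangle> \<Colon> x \<^bold>: \<one>"
| OneL: "\<Gamma> \<Zsemi> \<Delta> \<turnstile>\<^sub>I P \<Colon> z \<^bold>: C \<Longrightarrow> distinct_names (\<Gamma> + \<Delta>,, z \<^bold>: C,, x \<^bold>: \<one>) \<Longrightarrow>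
    \<Gamma> \<Zsemi> \<Delta>,, x \<^bold>: \<one> \<turnstile>\<^sub>I x\<lparr>\<rparr>\<cdot>P \<Colon> z \<^bold>: C"
| TensorR: "\<Gamma> \<Zsemi> \<Delta> \<turnstile>\<^sub>I P \<Colon> y \<^bold>: A \<Longrightarrow> \<Gamma> \<Zsemi> \<Delta>' \<turnstile>\<^sub>I Q \<Colon> x \<^bold>: B \<Longrightarrow>
    distinct_names (\<Gamma> + \<Delta> + \<Delta>',, x \<^bold>: A \<otimes> B) \<Longrightarrow>
    y \<notin> insert x (names \<Delta>') \<Longrightarrow>
    \<Gamma> \<Zsemi> \<Delta> + \<Delta>' \<turnstile>\<^sub>I (\<nu>y) x\<langle>y\<rangle>\<cdot>(P \<parallel> Q) \<Colon> x \<^bold>: A \<otimes> B"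
| TensorL: "\<Gamma> \<Zsemi> \<Delta>,, y \<^bold>: A,, x \<^bold>: B \<turnstile>\<^sub>I P \<Colon> z \<^bold>: C \<Longrightarrow>
    \<Gamma> \<Zsemi> \<Delta>,, x \<^bold>: A \<otimes> B \<turnstile>\<^sub>I x\<lparr>y\<rparr>\<cdot>P \<Colon> z \<^bold>: C"
| LolliR: "\<Gamma> \<Zsemi> \<Delta>,, y \<^bold>: A \<turnstile>\<^sub>I P \<Colon> x \<^bold>: B \<Longrightarrow>
    \<Gamma> \<Zsemi> \<Delta> \<turnstile>\<^sub>I x\<lparr>y\<rparr>\<cdot>P \<Colon> x \<^bold>: A \<multimap> B"
| LolliL: "\<Gamma> \<Zsemi> \<Delta> \<turnstile>\<^sub>I P \<Colon> y \<^bold>: A \<Longrightarrow> \<Gamma> \<Zsemi> \<Delta>',, x \<^bold>: B \<turnstile>\<^sub>I Q \<Colon> z \<^bold>: C \<Longrightarrow>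
    distinct_names (\<Gamma> + \<Delta> + \<Delta>',, z \<^bold>: C,, x \<^bold>: A \<multimap> B) \<Longrightarrow>
    y \<notin> insert x (insert z (names \<Delta>')) \<Longrightarrow>
    \<Gamma> \<Zsemi> \<Delta> + \<Delta>',, x \<^bold>: A \<multimap> B \<turnstile>\<^sub>I (\<nu>y) x\<langle>y\<rangle>\<cdot>(P \<parallel> Q) \<Colon> z \<^bold>: C"
| BangR: "\<Gamma> \<Zsemi> {#} \<turnstile>\<^sub>I P \<Colon> y \<^bold>: A \<Longrightarrow> distinct_names (\<Gamma>,, x \<^bold>: \<^bold>!A) \<Longrightarrow>
    \<Gamma> \<Zsemi> {#} \<turnstile>\<^sub>I \<^bold>!x\<lparr>y\<rparr>\<cdot>P \<Colon> x \<^bold>: \<^bold>!A"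
| BangL: "\<Gamma>,, u \<^bold>: A \<Zsemi> \<Delta> \<turnstile>\<^sub>I P \<Colon> z \<^bold>: C \<Longrightarrow> distinct_names (\<Gamma> + \<Delta>,, z \<^bold>: C,, x \<^bold>: \<^bold>!A) \<Longrightarrow>
    \<Gamma> \<Zsemi> \<Delta>,, x \<^bold>: \<^bold>!A \<turnstile>\<^sub>I P\<lbrace>x/u\<rbrace> \<Colon> z \<^bold>: C"

lemma ull_distinct: "\<Gamma> \<Zsemi> \<Delta> \<turnstile> P \<Colon> \<Lambda> \<Longrightarrow> distinct_names (\<Gamma> + \<Delta> + \<Lambda>)"
  by (induction rule: ull.induct)
    (simp_all add: distinct_names_union Int_Un_distrib Int_Un_distrib2)

lemma ill_distinct: "\<Gamma> \<Zsemi> \<Delta> \<turnstile>\<^sub>I P \<Colon> z \<^bold>: C \<Longrightarrow> distinct_names (\<Gamma> + \<Delta>,, z \<^bold>: C)"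
  by (induction rule: ill.induct)
    (simp_all add: distinct_names_union Int_Un_distrib Int_Un_distrib2)

definition ULL_typable :: "proc set" ("\<UU>") where
  "\<UU> = {P. \<exists>\<Gamma> \<Delta> \<Lambda>. \<Gamma> \<Zsemi> \<Delta> \<turnstile> P \<Colon> \<Lambda>}"

definition ILL_typable :: "proc set" ("\<II>") where
  "\<II> = {P. \<exists>\<Gamma> \<Delta>. \<exists>x \<in> fn P. \<exists>A. \<Gamma> \<Zsemi> \<Delta> \<turnstile>\<^sub>I P \<Colon> x \<^bold>: A}"

end

(* In piILL a name received by an input always enters the linear left zone, while a channel
   can only be closed (x<>.0) on the right. Hence x(y).x().y<>.0, which piULL types with
   x : 1 par bottom on the right, is not typable in piILL. *)
theory Submission
  imports Defs
begin

text \<open>Each intuitionistic rule is an instance of a classical one with a singleton right zone.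
  Where that zone must be split or extended, the instance is spelled out.\<close>

lemma ill_imp_ull: "\<Gamma> \<Zsemi> \<Delta> \<turnstile>\<^sub>I P \<Colon> z \<^bold>: C \<Longrightarrow> \<Gamma> \<Zsemi> \<Delta> \<turnstile> P \<Colon> {#},, z \<^bold>: C"
proof (induction rule: ill.induct)
  case (Cut \<Gamma> \<Delta> P x A \<Delta>' Q z C)
  then show ?case using ull.CutR[where \<Lambda> = "{#}" and \<Lambda>' = "{#},, z \<^bold>: C"] by simp
next
  case (OneL \<Gamma> \<Delta> P z C x)
  then show ?case using ull.OneL[where \<Lambda> = "{#},, z \<^bold>: C"] by auto
next
  case (TensorR \<Gamma> \<Delta> P y A \<Delta>' Q x B)
  then show ?case using ull.TensorR[where \<Lambda> = "{#}" and \<Lambda>' = "{#}"] by simp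
next
  case (LolliL \<Gamma> \<Delta> P y A \<Delta>' x B Q z C)
  then show ?case using ull.LolliL[where \<Lambda> = "{#}" and \<Lambda>' = "{#},, z \<^bold>: C"] by auto
next
  case (BangL \<Gamma> u A \<Delta> P z C x)
  then show ?case using ull.BangL[where \<Lambda> = "{#},, z \<^bold>: C"] by auto
qed (auto intro: ull.intros)

text \<open>The search passes through leading waits only, which suffices for the witness. It never
  enters a binder, so it commutes with every renaming, injective or not.\<close>

fun raw_closed :: "raw \<Rightarrow> name set" where
  "raw_closed (RClose x) = {x}"
| "raw_closed (RWait x P) = raw_closed P"
| "raw_closed _ = {}"

fun raw_closes_received :: "raw \<Rightarrow> bool" where
  "raw_closes_received (RIn x y P) \<longleftrightarrow> y \<in> raw_closed P"
| "raw_closes_received _ \<longleftrightarrow> False"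

lemma raw_closed_fn: "raw_closed P \<subseteq> raw_fn P"
  by (induction P) auto

lemma raw_closed_rename: "raw_closed (rename f P) = f ` raw_closed P"
  by (induction P arbitrary: f) (auto simp: Let_def)

text \<open>The new binder avoids the images of the other free names of the body, so no other closed
  name can be confused with it.\<close>

lemma raw_closes_received_rename: "raw_closes_received (rename f P) = raw_closes_received P"
proof (cases P)
  case (RIn x y Q)
  have "fresh (f ` (raw_fn Q - {y})) \<notin> f ` (raw_fn Q - {y})"
    by (rule fresh_notin) simp
  then show ?thesis
    using raw_closed_fn[of Q] by (auto simp: RIn Let_def raw_closed_rename)
qed (auto simp: Let_def)

lift_definition closed :: "proc \<Rightarrow> name set" is raw_closed
  by (metis alpha_iff image_id id_apply raw_closed_rename)

lift_definition closes_received :: "proc \<Rightarrow> bool" is raw_closes_received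
  by (metis alpha_iff raw_closes_received_rename)

lemma closed_simps [simp]:
  "closed [x\<leftrightarrow>y] = {}"
  "closed ((\<nu>x) P) = {}"
  "closed (x\<lparr>y\<rparr>\<cdot>P) = {}"
  "closed (\<^bold>!x\<lparr>y\<rparr>\<cdot>P) = {}"
  "closed (x\<langle>\<rangle>) = {x}"
  "closed (x\<lparr>\<rparr>\<cdot>P) = closed P"
  by (transfer, simp)+

lemma closes_received_simps [simp]:
  "\<not> closes_received [x\<leftrightarrow>y]"
  "\<not> closes_received ((\<nu>x) P)"
  "closes_received (x\<lparr>y\<rparr>\<cdot>P) \<longleftrightarrow> y \<in> closed P"
  "\<not> closes_received (\<^bold>!x\<lparr>y\<rparr>\<cdot>P)"
  "\<not> closes_received (x\<langle>\<rangle>)"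
  "\<not> closes_received (x\<lparr>\<rparr>\<cdot>P)"
  by (transfer, simp)+

lemma closed_subst: "closed (P\<lbrace>y/x\<rbrace>) = id(x := y) ` closed P"
  by transfer (simp add: raw_subst_def raw_closed_rename)

lemma closes_received_subst [simp]: "closes_received (P\<lbrace>y/x\<rbrace>) = closes_received P"
  by transfer (simp add: raw_subst_def raw_closes_received_rename)

text \<open>Only \<open>OneR\<close> introduces a close, on the right-hand name. \<open>OneL\<close>
  preserves the set and \<open>BangL\<close> renames in it; all other rules give a process where it
  is empty.\<close>

lemma ill_closed: "\<Gamma> \<Zsemi> \<Delta> \<turnstile>\<^sub>I P \<Colon> z \<^bold>: C \<Longrightarrow> closed P \<subseteq> {z}"
proof (induction rule: ill.induct)
  case (BangL \<Gamma> u A \<Delta> P z C x)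
  \<comment> \<open>Hence replacing \<open>u\<close> by \<open>x\<close> leaves \<open>z\<close>
    fixed.\<close>
  have "z \<noteq> u" using ill_distinct[OF BangL.hyps(1)] by auto
  then show ?case using BangL.IH by (auto simp: closed_subst)
qed auto

text \<open>Only \<open>TensorL\<close> and \<open>LolliR\<close> introduce an input. There the
  received name lies in the left zone of the premise, so it differs from the one name that
  \<open>ill_closed\<close> allows.\<close>

lemma ill_not_closes_received: "\<Gamma> \<Zsemi> \<Delta> \<turnstile>\<^sub>I P \<Colon> z \<^bold>: C \<Longrightarrow> \<not> closes_received P"
proof (induction rule: ill.induct)
  case (TensorL \<Gamma> \<Delta> y A x B P z C)
  then show ?case using ill_closed[OF TensorL.hyps] ill_distinct[OF TensorL.hyps] by auto
next
  case (LolliR \<Gamma> \<Delta> y A P x B)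
  then show ?case using ill_closed[OF LolliR.hyps] ill_distinct[OF LolliR.hyps] by auto
qed auto

lemma ull_input_wait_close:
  assumes "x \<noteq> y"
  shows "{#} \<Zsemi> {#} \<turnstile> x\<lparr>y\<rparr>\<cdot>(x\<lparr>\<rparr>\<cdot>(y\<langle>\<rangle>)) \<Colon> {#},, x \<^bold>: \<one> \<parr> \<bottom>"
proof -
  have "{#} \<Zsemi> {#} \<turnstile> y\<langle>\<rangle> \<Colon> {#},, y \<^bold>: \<one>"
    by (rule ull.OneR) simp
  \<comment> \<open>Here the right zone holds two assignments, which no intuitionistic sequent
    can.\<close>
  then have "{#} \<Zsemi> {#} \<turnstile> x\<lparr>\<rparr>\<cdot>(y\<langle>\<rangle>) \<Colon> {#},, y \<^bold>: \<one>,, x \<^bold>: \<bottom>"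
    by (rule ull.BotR) (simp add: assms)
  then show ?thesis by (rule ull.ParR)
qed

theorem theorem3p3:
  shows "\<II> \<subset> \<UU>"
proof
  show "\<II> \<subseteq> \<UU>"
    unfolding ILL_typable_def ULL_typable_def by (blast dest: ill_imp_ull)
  \<comment> \<open>Names are naturals; any two distinct ones would serve.\<close>
  let ?P = "0\<lparr>1\<rparr>\<cdot>(0\<lparr>\<rparr>\<cdot>(1\<langle>\<rangle>))"
  have "?P \<in> \<UU>"
    unfolding ULL_typable_def using ull_input_wait_close[of 0 1] by auto
  moreover have "?P \<notin> \<II>"
    unfolding ILL_typable_def by (auto dest: ill_not_closes_received)
  ultimately show "\<II> \<noteq> \<UU>" by blast
qed

end
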